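(* Let $\alpha: I\subset\mathbb{R}\to S^3$ be a regular curve parametrized by arc length $s$ in the three-dimensional Lie group $S^3$ with its bi-invariant metric $\langle\,,\rangle$, with Frenet vector fields $\{T,N,B\}$ and curvatures $\varkappa,\tau$. If the two-component spinor $\phi$ along $\alpha$ represents the triad $\{N,B,T\}$, then the Frenet equations $$\frac{dT}{ds}=\varkappa N,\qquad \frac{dN}{ds}=-\varkappa T+(\tau-1)B,\qquad \frac{dB}{ds}=-(\tau-1)N$$ are equivalent to the single spinor equation $$\frac{d\phi}{ds}=-i\,\frac{\tau-1}{2}\,\phi+\frac{\varkappa}{2}\,\widehat{\phi}.$$
   Context: $S^3$ denotes the Lie group of unit quaternions with the bi-invariant metric and orientation normalized so that $\tau_G:=\frac12\langle[T,N],B\rangle=1$ for every curve, i.e. there is a positively oriented orthonormal basis $\{X_1,X_2,X_3\}$ of the Lie algebra $\mathfrak g$ with $[X_1,X_2]=2X_3$, $[X_2,X_3]=2X_1$, $[X_3,X_1]=2X_2$. Fix such a basis. Let $D$ be the Levi-Civita connection, so that $D_XY=\frac12[X,Y]$ for $X,Y\in\mathfrak g$ (left-invariant vector fields). A vector field along $\alpha$ is written $W=\sum_i w_iX_i$ with smooth functions $w_i:I\to\mathbb R$, and is identified with $(w_1,w_2,w_3)\in\mathbb R^3$. The bracket of two such fields is taken pointwise, $[W,Z]=\sum_{i,j}w_iz_j[X_i,X_j]$. The notation $\frac{dW}{ds}=\dot W=\sum_i\dot w_iX_i$ means the componentwise derivative; the covariant derivative is $D_{\alpha'}W=\dot W+\frac12[T,W]$,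 where $T=\alpha'$. The Frenet apparatus $(T,N,B,\varkappa,\tau)$ of the arc-length curve $\alpha$ consists of $T=\alpha'$, the orthonormal, positively oriented frame $\{T,N,B\}$ and the curvatures $\varkappa=\|\dot T\|$ (nonzero, so that the frame is defined) and $\tau$, for which $D_TT=\varkappa N$, $D_TN=-\varkappa T+\tau B$, $D_TB=-\tau N$. A spinor is a column $\phi=\begin{pmatrix}\phi_1\\ \phi_2\end{pmatrix}\in\mathbb C^2$; its mate is $\widehat\phi=\begin{pmatrix}-\overline{\phi_2}\\ \overline{\phi_1}\end{pmatrix}$. Let $\sigma=(\sigma_1,\sigma_2,\sigma_3)$ with $\sigma_1=\begin{pmatrix}1&0\\0&-1\end{pmatrix}$, $\sigma_2=\begin{pmatrix}i&0\\0&i\end{pmatrix}$, $\sigma_3=\begin{pmatrix}0&-1\\-1&0\end{pmatrix}$, and for spinors $\psi,\phi$ let $\psi^t\sigma\phi=(\psi^t\sigma_1\phi,\psi^t\sigma_2\phi,\psi^t\sigma_3\phi)\in\mathbb C^3$. A spinor $\phi$ along $\alpha$ (a differentiable function $I\to\mathbb C^2$) represents the triad $\{N,B,T\}$ if at each point $N+iB=\phi^t\sigma\phi$ and $T=-\widehat\phi^{\,t}\sigma\phi$, with $\overline{\phi}^{\,t}\phi=1$. Such a spinor is determined up to sign. *)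

theory Defs
  imports "HOL-Analysis.Analysis"
begin

text \<open>Quaternions as pairs (real part, imaginary part). The product norm is the quaternion norm,
  so the group of unit quaternions is \<open>sphere 0 1\<close>, and the Euclidean inner product restricts
  to a bi-invariant metric on it.\<close>

type_synonym quat = "real \<times> (real^3)"

definition qmult :: "quat \<Rightarrow> quat \<Rightarrow> quat" where
  "qmult p q = (fst p * fst q - snd p \<bullet> snd q,
                fst p *\<^sub>R snd q + fst q *\<^sub>R snd p + cross3 (snd p) (snd q))"

definition S3 :: "quat set" where
  "S3 = sphere 0 1"

text \<open>The Lie algebra is the tangent space of \<open>S3\<close> at the unit \<open>(1, 0)\<close>; an element \<open>x\<close> of it
  stands for the left-invariant vector field \<open>g \<mapsto> qmult g x\<close>.\<close>

definition S3_lie_algebra :: "quat set" where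
  "S3_lie_algebra = {x. fst x = 0}"

definition lie_bracket :: "quat \<Rightarrow> quat \<Rightarrow> quat" where
  "lie_bracket x y = qmult x y - qmult y x"

text \<open>The bracket relations also fix the orientation: such a basis is positively oriented
  by convention.\<close>

definition adapted_basis :: "(3 \<Rightarrow> quat) \<Rightarrow> bool" where
  "adapted_basis X \<longleftrightarrow>
     (\<forall>i. X i \<in> S3_lie_algebra) \<and>
     (\<forall>i j. X i \<bullet> X j = (if i = j then 1 else 0)) \<and>
     lie_bracket (X 1) (X 2) = 2 *\<^sub>R X 3 \<and>
     lie_bracket (X 2) (X 3) = 2 *\<^sub>R X 1 \<and>
     lie_bracket (X 3) (X 1) = 2 *\<^sub>R X 2"

text \<open>A vector field along a curve is given by its coefficient function \<open>real \<Rightarrow> real^3\<close> with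
  respect to \<open>X\<close>; \<open>lin_comb\<close> recovers the Lie algebra element.\<close>

definition lin_comb :: "(3 \<Rightarrow> quat) \<Rightarrow> real^3 \<Rightarrow> quat" where
  "lin_comb X w = (\<Sum>i\<in>UNIV. w $ i *\<^sub>R X i)"

definition nondegenerate_interval :: "real set \<Rightarrow> bool" where
  "nondegenerate_interval I \<longleftrightarrow> is_interval I \<and> (\<exists>a\<in>I. \<exists>b\<in>I. a < b)"

text \<open>Infinite differentiability; \<open>F k\<close> is the \<open>k\<close>-th derivative, one-sided at endpoints
  belonging to \<open>I\<close>.\<close>

definition smooth_along :: "real set \<Rightarrow> (real \<Rightarrow> 'a::real_normed_vector) \<Rightarrow> bool" where
  "smooth_along I f \<longleftrightarrow>
     (\<exists>F. F 0 = f \<and> (\<forall>k. \<forall>s\<in>I. (F k has_vector_derivative F (Suc k) s) (at s within I)))"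

definition arc_length_curve :: "real set \<Rightarrow> (real \<Rightarrow> quat) \<Rightarrow> bool" where
  "arc_length_curve I \<alpha> \<longleftrightarrow>
     smooth_along I \<alpha> \<and> (\<forall>s\<in>I. \<alpha> s \<in> S3) \<and>
     (\<forall>s\<in>I. norm (vector_derivative \<alpha> (at s within I)) = 1)"

definition adapted_frame ::
  "(3 \<Rightarrow> quat) \<Rightarrow> real set \<Rightarrow> (real \<Rightarrow> quat) \<Rightarrow>
   (real \<Rightarrow> real^3) \<Rightarrow> (real \<Rightarrow> real^3) \<Rightarrow> (real \<Rightarrow> real^3) \<Rightarrow> bool" where
  "adapted_frame X I \<alpha> T N B \<longleftrightarrow>
     smooth_along I T \<and> smooth_along I N \<and> smooth_along I B \<and>
     (\<forall>s\<in>I.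
       (\<alpha> has_vector_derivative qmult (\<alpha> s) (lin_comb X (T s))) (at s within I) \<and>
       norm (T s) = 1 \<and> norm (N s) = 1 \<and> norm (B s) = 1 \<and>
       T s \<bullet> N s = 0 \<and> T s \<bullet> B s = 0 \<and> N s \<bullet> B s = 0 \<and>
       0 < det (vector [T s, N s, B s] :: real^3^3))"

text \<open>The covariant derivative along the curve with velocity \<open>T\<close>: for the bi-invariant metric
  \<open>D\<^sub>X Y = 1/2 [X, Y]\<close> on left-invariant fields.\<close>

definition cov_deriv ::
  "(3 \<Rightarrow> quat) \<Rightarrow> real set \<Rightarrow> (real \<Rightarrow> real^3) \<Rightarrow> (real \<Rightarrow> real^3) \<Rightarrow> real \<Rightarrow> quat" where
  "cov_deriv X I T W s =
     lin_comb X (vector_derivative W (at s within I))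
     + (1/2) *\<^sub>R lie_bracket (lin_comb X (T s)) (lin_comb X (W s))"

definition frenet_apparatus ::
  "(3 \<Rightarrow> quat) \<Rightarrow> real set \<Rightarrow> (real \<Rightarrow> quat) \<Rightarrow>
   (real \<Rightarrow> real^3) \<Rightarrow> (real \<Rightarrow> real^3) \<Rightarrow> (real \<Rightarrow> real^3) \<Rightarrow>
   (real \<Rightarrow> real) \<Rightarrow> (real \<Rightarrow> real) \<Rightarrow> bool" where
  "frenet_apparatus X I \<alpha> T N B \<kappa> \<tau> \<longleftrightarrow>
     adapted_frame X I \<alpha> T N B \<and>
     (\<forall>s\<in>I.
       \<kappa> s = norm (vector_derivative T (at s within I)) \<and> \<kappa> s \<noteq> 0 \<and>
       cov_deriv X I T T s = lin_comb X (\<kappa> s *\<^sub>R N s) \<and>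
       cov_deriv X I T N s = lin_comb X (- \<kappa> s *\<^sub>R T s + \<tau> s *\<^sub>R B s) \<and>
       cov_deriv X I T B s = lin_comb X (- \<tau> s *\<^sub>R N s))"

definition mate :: "complex^2 \<Rightarrow> complex^2" where
  "mate \<phi> = vector [- cnj (\<phi> $ 2), cnj (\<phi> $ 1)]"

definition sigma1 :: "complex^2^2" where
  "sigma1 = vector [vector [1, 0], vector [0, -1]]"

definition sigma2 :: "complex^2^2" where
  "sigma2 = vector [vector [\<i>, 0], vector [0, \<i>]]"

definition sigma3 :: "complex^2^2" where
  "sigma3 = vector [vector [0, -1], vector [-1, 0]]"

text \<open>No conjugation here, in contrast to the Hermitian inner product.\<close>

definition bilin :: "complex^2 \<Rightarrow> complex^2^2 \<Rightarrow> complex^2 \<Rightarrow> complex" where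
  "bilin \<psi> M \<phi> = (\<Sum>i\<in>UNIV. \<psi> $ i * (M *v \<phi>) $ i)"

definition spin_form :: "complex^2 \<Rightarrow> complex^2 \<Rightarrow> complex^3" where
  "spin_form \<psi> \<phi> = vector [bilin \<psi> sigma1 \<phi>, bilin \<psi> sigma2 \<phi>, bilin \<psi> sigma3 \<phi>]"

definition represents_triad ::
  "real set \<Rightarrow> (real \<Rightarrow> complex^2) \<Rightarrow>
   (real \<Rightarrow> real^3) \<Rightarrow> (real \<Rightarrow> real^3) \<Rightarrow> (real \<Rightarrow> real^3) \<Rightarrow> bool" where
  "represents_triad I \<phi> N B T \<longleftrightarrow>
     \<phi> differentiable_on I \<and>
     (\<forall>s\<in>I.
       (\<chi> k. complex_of_real (N s $ k) + \<i> * complex_of_real (B s $ k)) = spin_form (\<phi> s) (\<phi> s) \<and>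
       (\<chi> k. complex_of_real (T s $ k)) = - spin_form (mate (\<phi> s)) (\<phi> s) \<and>
       (\<Sum>i\<in>UNIV. cnj (\<phi> s $ i) * \<phi> s $ i) = 1)"

text \<open>Componentwise (not covariant) derivatives.\<close>

definition frenet_equations ::
  "real set \<Rightarrow> (real \<Rightarrow> real^3) \<Rightarrow> (real \<Rightarrow> real^3) \<Rightarrow> (real \<Rightarrow> real^3) \<Rightarrow>
   (real \<Rightarrow> real) \<Rightarrow> (real \<Rightarrow> real) \<Rightarrow> bool" where
  "frenet_equations I T N B \<kappa> \<tau> \<longleftrightarrow>
     (\<forall>s\<in>I.
       (T has_vector_derivative \<kappa> s *\<^sub>R N s) (at s within I) \<and>
       (N has_vector_derivative (- \<kappa> s *\<^sub>R T s + (\<tau> s - 1) *\<^sub>R B s)) (at s within I) \<and>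
       (B has_vector_derivative (- (\<tau> s - 1) *\<^sub>R N s)) (at s within I))"

definition spinor_equation ::
  "real set \<Rightarrow> (real \<Rightarrow> complex^2) \<Rightarrow> (real \<Rightarrow> real) \<Rightarrow> (real \<Rightarrow> real) \<Rightarrow> bool" where
  "spinor_equation I \<phi> \<kappa> \<tau> \<longleftrightarrow>
     (\<forall>s\<in>I.
       (\<phi> has_vector_derivative
          ((- \<i> * complex_of_real ((\<tau> s - 1) / 2)) *s \<phi> s
           + complex_of_real (\<kappa> s / 2) *s mate (\<phi> s)))
         (at s within I))"

end

theory Submission
  imports Defs
begin

text \<open>Write \<open>Q \<psi> \<phi> = \<psi>\<^sup>t\<sigma>\<phi>\<close>. This is a symmetric complex bilinear map, so along the curve
  \<open>N + iB = Q \<phi> \<phi>\<close> differentiates to \<open>N' + iB' = 2 Q \<phi> \<phi>'\<close>. If \<open>\<phi>'\<close> is the right-hand side of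
  the spinor equation, then \<open>2 Q \<phi> \<phi>' = -\<kappa>T - i(\<tau> - 1)(N + iB)\<close>, which is exactly the pair of
  Frenet equations for \<open>N\<close> and \<open>B\<close>; the equation for \<open>T\<close> follows in the same way from
  \<open>T = - Q (mate \<phi>) \<phi>\<close> (lemmas \<open>spin_form_spinor_rhs\<close> and \<open>spin_form_mate_spinor_rhs\<close>).
  Conversely, \<open>Q \<phi>\<close> is injective whenever \<open>\<phi> \<noteq> 0\<close> (lemma \<open>spin_form_cancel_left\<close>), so the
  equations for \<open>N\<close> and \<open>B\<close> already determine \<open>\<phi>'\<close>.

  It remains to see that the Frenet apparatus satisfies the componentwise equations. In
  coordinates with respect to an adapted basis, half the bracket is the cross product
  (lemma \<open>lie_bracket_lin_comb\<close>), and hence the covariant derivative of \<open>W\<close> is \<open>W' + T \<times> W\<close>.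
  Since \<open>T \<times> N = B\<close> and \<open>T \<times> B = - N\<close>, the passage from covariant to componentwise derivatives
  replaces \<open>\<tau>\<close> by \<open>\<tau> - 1\<close>.\<close>

section \<open>The spinor form\<close>

lemma mate_nth [simp]: "mate \<phi> $ 1 = - cnj (\<phi> $ 2)" "mate \<phi> $ 2 = cnj (\<phi> $ 1)"
  by (simp_all add: mate_def)

lemma spin_form_nth [simp]:
  "spin_form \<psi> \<phi> $ 1 = \<psi> $ 1 * \<phi> $ 1 - \<psi> $ 2 * \<phi> $ 2"
  "spin_form \<psi> \<phi> $ 2 = \<i> * (\<psi> $ 1 * \<phi> $ 1 + \<psi> $ 2 * \<phi> $ 2)"
  "spin_form \<psi> \<phi> $ 3 = - (\<psi> $ 1 * \<phi> $ 2 + \<psi> $ 2 * \<phi> $ 1)"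
  by (simp_all add: spin_form_def bilin_def sigma1_def sigma2_def sigma3_def sum_2
      matrix_vector_mult_def algebra_simps)

lemma spin_form_commute: "spin_form \<psi> \<phi> = spin_form \<phi> \<psi>"
  by (simp add: vec_eq_iff forall_3 algebra_simps)

lemma bounded_bilinear_spin_form: "bounded_bilinear spin_form"
  unfolding bilinear_conv_bounded_bilinear [symmetric] bilinear_def
  by (auto intro!: linearI simp: vec_eq_iff forall_3 algebra_simps scaleR_conv_of_real [where 'a = complex])

lemma bounded_linear_mate: "bounded_linear mate"
  unfolding linear_conv_bounded_linear [symmetric]
  by (auto intro!: linearI simp: vec_eq_iff forall_2 algebra_simps)

lemma spin_form_cancel_left:
  assumes "spin_form \<phi> \<psi> = spin_form \<phi> \<omega>" and "\<phi> \<noteq> 0"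
  shows "\<psi> = \<omega>"
proof -
  define a b e f where "a = \<phi> $ 1" and "b = \<phi> $ 2"
    and "e = \<psi> $ 1 - \<omega> $ 1" and "f = \<psi> $ 2 - \<omega> $ 2"
  have ab: "a \<noteq> 0 \<or> b \<noteq> 0"
    using assms(2) by (auto simp: vec_eq_iff forall_2 a_def b_def)
  have "a * e - b * f = 0" "\<i> * (a * e + b * f) = 0" "a * f + b * e = 0"
    using assms(1) by (simp_all add: vec_eq_iff forall_3 a_def b_def e_def f_def algebra_simps)
  then have "a * e = 0" "b * f = 0" "a * f + b * e = 0"
    by auto
  with ab have "e = 0" "f = 0"
    by auto
  then show ?thesis
    by (simp add: vec_eq_iff forall_2 e_def f_def)
qed

text \<open>The vector \<open>v + i w\<close> of \<open>\<complex>\<^sup>3\<close> with given real and imaginary parts.\<close>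

definition complex_vec :: "real^3 \<Rightarrow> real^3 \<Rightarrow> complex^3" where
  "complex_vec v w = (\<chi> k. complex_of_real (v $ k) + \<i> * complex_of_real (w $ k))"

lemma complex_vec_nth [simp]:
  "complex_vec v w $ k = complex_of_real (v $ k) + \<i> * complex_of_real (w $ k)"
  by (simp add: complex_vec_def)

lemma has_vector_derivative_complex_vec_iff:
  "((\<lambda>s. complex_vec (f s) (g s)) has_vector_derivative complex_vec f' g') (at x within S) \<longleftrightarrow>
   (f has_vector_derivative f') (at x within S) \<and> (g has_vector_derivative g') (at x within S)"
proof (intro iffI conjI)
  have Re: "bounded_linear (\<lambda>z::complex^3. \<chi> k. Re (z $ k))"
    and Im: "bounded_linear (\<lambda>z::complex^3. \<chi> k. Im (z $ k))"
    unfolding linear_conv_bounded_linear [symmetric]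
    by (auto intro!: linearI simp: vec_eq_iff)
  assume *: "((\<lambda>s. complex_vec (f s) (g s)) has_vector_derivative complex_vec f' g') (at x within S)"
  show "(f has_vector_derivative f') (at x within S)"
    using bounded_linear.has_vector_derivative [OF Re *] by simp
  show "(g has_vector_derivative g') (at x within S)"
    using bounded_linear.has_vector_derivative [OF Im *] by simp
next
  have lin: "bounded_linear (\<lambda>p. complex_vec (fst p) (snd p))"
    unfolding linear_conv_bounded_linear [symmetric]
    by (auto intro!: linearI simp: vec_eq_iff algebra_simps scaleR_conv_of_real [where 'a = complex])
  assume "(f has_vector_derivative f') (at x within S) \<and> (g has_vector_derivative g') (at x within S)"
  then show "((\<lambda>s. complex_vec (f s) (g s)) has_vector_derivative complex_vec f' g') (at x within S)"
    using bounded_linear.has_vector_derivative [OF lin has_vector_derivative_Pair] by simp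
qed

section \<open>The spinor equation at a point\<close>

text \<open>The right-hand side of the spinor equation, with \<open>c\<close> in place of \<open>\<tau> - 1\<close>.\<close>

definition spinor_rhs :: "real \<Rightarrow> real \<Rightarrow> complex^2 \<Rightarrow> complex^2" where
  "spinor_rhs c k \<phi> = (- \<i> * complex_of_real (c / 2)) *s \<phi> + complex_of_real (k / 2) *s mate \<phi>"

lemma spin_form_spinor_rhs:
  assumes NB: "complex_vec n b = spin_form \<phi> \<phi>"
    and T: "complex_vec t 0 = - spin_form (mate \<phi>) \<phi>"
  shows "2 *\<^sub>R spin_form \<phi> (spinor_rhs c k \<phi>) = complex_vec (- k *\<^sub>R t + c *\<^sub>R b) (- c *\<^sub>R n)"
proof -
  have "2 *\<^sub>R spin_form \<phi> (spinor_rhs c k \<phi>) =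
      (- \<i> * of_real c) *s spin_form \<phi> \<phi> + of_real k *s spin_form (mate \<phi>) \<phi>"
    by (simp add: spinor_rhs_def vec_eq_iff forall_3 scaleR_conv_of_real field_simps)
  also have "\<dots> = (- \<i> * of_real c) *s complex_vec n b - of_real k *s complex_vec t 0"
    using NB T by (simp add: vec_eq_iff)
  also have "\<dots> = complex_vec (- k *\<^sub>R t + c *\<^sub>R b) (- c *\<^sub>R n)"
    by (simp add: vec_eq_iff algebra_simps complex_eq_iff)
  finally show ?thesis .
qed

text \<open>In the derivative of \<open>Q (mate \<phi>) \<phi>\<close> the terms with \<open>c\<close> cancel, because \<open>mate\<close> is
  conjugate-linear. The remaining terms combine to \<open>N\<close> because \<open>Q (mate \<phi>) (mate \<phi>)\<close> is the
  negative of the conjugate of \<open>Q \<phi> \<phi>\<close>.\<close>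

lemma spin_form_mate_spinor_rhs:
  assumes NB: "complex_vec n b = spin_form \<phi> \<phi>"
  shows "spin_form (mate \<phi>) (spinor_rhs c k \<phi>) + spin_form (mate (spinor_rhs c k \<phi>)) \<phi> =
    - complex_vec (k *\<^sub>R n) 0"
proof -
  have conj: "spin_form (mate \<phi>) (mate \<phi>) = - complex_vec n (- b)"
  proof -
    have "spin_form (mate \<phi>) (mate \<phi>) = - (\<chi> j. cnj (spin_form \<phi> \<phi> $ j))"
      by (simp add: vec_eq_iff forall_3 algebra_simps)
    also have "\<dots> = - complex_vec n (- b)"
      unfolding NB [symmetric] by (simp add: vec_eq_iff)
    finally show ?thesis .
  qed
  have "spin_form (mate \<phi>) (spinor_rhs c k \<phi>) + spin_form (mate (spinor_rhs c k \<phi>)) \<phi> =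
      of_real (k / 2) *s (spin_form (mate \<phi>) (mate \<phi>) - spin_form \<phi> \<phi>)"
    by (simp add: spinor_rhs_def vec_eq_iff forall_3 field_simps)
  also have "\<dots> = of_real (k / 2) *s (- complex_vec n (- b) - complex_vec n b)"
    by (simp only: NB conj)
  also have "\<dots> = - complex_vec (k *\<^sub>R n) 0"
    by (simp add: vec_eq_iff algebra_simps)
  finally show ?thesis .
qed

section \<open>Equivalence of the two systems\<close>

text \<open>This is what makes derivatives within \<open>I\<close> unique, including at endpoints.\<close>

lemma nondegenerate_interval_nontrivial_limit:
  assumes "nondegenerate_interval I" and "s \<in> I"
  shows "at s within I \<noteq> bot"
proof -
  have "connected I" "\<nexists>x. I = {x}"
    using assms(1) by (auto simp: nondegenerate_interval_def is_interval_connected)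
  then show ?thesis
    using connected_imp_perfect [of I s] assms(2) by (auto simp: trivial_limit_within)
qed

lemma has_vector_derivative_complex_vec_spin_form:
  assumes "s \<in> I" and "\<And>s. s \<in> I \<Longrightarrow> complex_vec (n s) (b s) = spin_form (\<phi> s) (\<phi> s)"
    and "(\<phi> has_vector_derivative \<phi>') (at s within I)"
  shows "((\<lambda>s. complex_vec (n s) (b s)) has_vector_derivative 2 *\<^sub>R spin_form (\<phi> s) \<phi>')
    (at s within I)"
proof (rule has_vector_derivative_transform [OF assms(1,2)])
  show "((\<lambda>s. spin_form (\<phi> s) (\<phi> s)) has_vector_derivative 2 *\<^sub>R spin_form (\<phi> s) \<phi>')
      (at s within I)"
    using bounded_bilinear.has_vector_derivative
      [OF bounded_bilinear_spin_form assms(3) assms(3)]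
    by (simp add: spin_form_commute [of \<phi>'] scaleR_2)
qed

lemma frenet_equations_iff_spinor_equation:
  assumes I: "nondegenerate_interval I" and rep: "represents_triad I \<phi> N B T"
  shows "frenet_equations I T N B \<kappa> \<tau> \<longleftrightarrow> spinor_equation I \<phi> \<kappa> \<tau>"
proof -
  have NB: "complex_vec (N s) (B s) = spin_form (\<phi> s) (\<phi> s)" if "s \<in> I" for s
    using rep that by (simp add: represents_triad_def complex_vec_def)
  have T: "complex_vec (T s) 0 = - spin_form (mate (\<phi> s)) (\<phi> s)" if "s \<in> I" for s
    using rep that by (simp add: represents_triad_def complex_vec_def)
  show ?thesis
  proof
    assume F: "frenet_equations I T N B \<kappa> \<tau>"
    show "spinor_equation I \<phi> \<kappa> \<tau>"
      unfolding spinor_equation_def spinor_rhs_def [symmetric]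
    proof
      fix s assume s: "s \<in> I"
      define D where "D = vector_derivative \<phi> (at s within I)"
      have D: "(\<phi> has_vector_derivative D) (at s within I)"
        using rep s unfolding D_def vector_derivative_works [symmetric]
        by (simp add: represents_triad_def differentiable_on_def)
      have "((\<lambda>s. complex_vec (N s) (B s)) has_vector_derivative
          complex_vec (- \<kappa> s *\<^sub>R T s + (\<tau> s - 1) *\<^sub>R B s) (- (\<tau> s - 1) *\<^sub>R N s)) (at s within I)"
        using F s unfolding has_vector_derivative_complex_vec_iff
        by (simp add: frenet_equations_def)
      then have "complex_vec (- \<kappa> s *\<^sub>R T s + (\<tau> s - 1) *\<^sub>R B s) (- (\<tau> s - 1) *\<^sub>R N s) =
          2 *\<^sub>R spin_form (\<phi> s) D"
        using nondegenerate_interval_nontrivial_limit [OF I s]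
          has_vector_derivative_complex_vec_spin_form [OF s NB D]
        by (blast intro: vector_derivative_unique_within)
      then have "spin_form (\<phi> s) D = spin_form (\<phi> s) (spinor_rhs (\<tau> s - 1) (\<kappa> s) (\<phi> s))"
        unfolding spin_form_spinor_rhs [OF NB [OF s] T [OF s], symmetric] by simp
      moreover have "\<phi> s \<noteq> 0"
        using rep s by (auto simp: represents_triad_def)
      ultimately have "D = spinor_rhs (\<tau> s - 1) (\<kappa> s) (\<phi> s)"
        by (rule spin_form_cancel_left)
      with D show "(\<phi> has_vector_derivative spinor_rhs (\<tau> s - 1) (\<kappa> s) (\<phi> s)) (at s within I)"
        by simp
    qed
  next
    assume S: "spinor_equation I \<phi> \<kappa> \<tau>"
    show "frenet_equations I T N B \<kappa> \<tau>"
      unfolding frenet_equations_def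
    proof
      fix s assume s: "s \<in> I"
      define D where "D = spinor_rhs (\<tau> s - 1) (\<kappa> s) (\<phi> s)"
      have D: "(\<phi> has_vector_derivative D) (at s within I)"
        using S s by (simp add: spinor_equation_def spinor_rhs_def D_def)
      have "((\<lambda>s. complex_vec (N s) (B s)) has_vector_derivative
          complex_vec (- \<kappa> s *\<^sub>R T s + (\<tau> s - 1) *\<^sub>R B s) (- (\<tau> s - 1) *\<^sub>R N s)) (at s within I)"
        using has_vector_derivative_complex_vec_spin_form [OF s NB D]
        unfolding D_def spin_form_spinor_rhs [OF NB [OF s] T [OF s]] .
      moreover have "((\<lambda>s. complex_vec (T s) 0) has_vector_derivative
          complex_vec (\<kappa> s *\<^sub>R N s) 0) (at s within I)"
      proof (rule has_vector_derivative_transform [OF s T])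
        have "((\<lambda>s. - spin_form (mate (\<phi> s)) (\<phi> s)) has_vector_derivative
            - (spin_form (mate (\<phi> s)) D + spin_form (mate D) (\<phi> s))) (at s within I)"
          by (intro has_vector_derivative_minus D
              bounded_bilinear.has_vector_derivative [OF bounded_bilinear_spin_form]
              bounded_linear.has_vector_derivative [OF bounded_linear_mate])
        then show "((\<lambda>s. - spin_form (mate (\<phi> s)) (\<phi> s)) has_vector_derivative
            complex_vec (\<kappa> s *\<^sub>R N s) 0) (at s within I)"
          unfolding D_def spin_form_mate_spinor_rhs [OF NB [OF s]] by simp
      qed
      ultimately show "(T has_vector_derivative \<kappa> s *\<^sub>R N s) (at s within I) \<and>
          (N has_vector_derivative - \<kappa> s *\<^sub>R T s + (\<tau> s - 1) *\<^sub>R B s) (at s within I) \<and>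
          (B has_vector_derivative - (\<tau> s - 1) *\<^sub>R N s) (at s within I)"
        unfolding has_vector_derivative_complex_vec_iff by simp
    qed
  qed
qed

section \<open>From covariant to componentwise derivatives\<close>

lemma lie_bracket_eq_cross3: "lie_bracket x y = (0, 2 *\<^sub>R cross3 (snd x) (snd y))"
proof -
  have "cross3 (snd y) (snd x) = - cross3 (snd x) (snd y)"
    by (rule cross_skew)
  then show ?thesis
    by (simp add: lie_bracket_def qmult_def inner_commute scaleR_2)
qed

lemma linear_lin_comb: "linear (lin_comb X)"
  by (auto intro!: linearI
      simp: lin_comb_def sum.distrib scaleR_sum_right scaleR_add_left)

lemma lin_comb_eq_iff:
  assumes "adapted_basis X"
  shows "lin_comb X v = lin_comb X w \<longleftrightarrow> v = w"
proof
  have ortho: "X j \<bullet> X i = (if j = i then 1 else 0)" for i j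
    using assms by (simp add: adapted_basis_def)
  have coeff: "lin_comb X u \<bullet> X i = u $ i" for u i
    by (simp add: lin_comb_def inner_sum_left ortho if_distrib cong: if_cong)
  assume "lin_comb X v = lin_comb X w"
  then have "v $ i = w $ i" for i
    using coeff [of v i] coeff [of w i] by simp
  then show "v = w"
    by (simp add: vec_eq_iff)
qed simp

lemma lie_bracket_lin_comb:
  assumes "adapted_basis X"
  shows "lie_bracket (lin_comb X v) (lin_comb X w) = 2 *\<^sub>R lin_comb X (cross3 v w)"
proof -
  define Y where "Y = (\<lambda>i. snd (X i))"
  have X: "X i = (0, Y i)" for i
    using assms by (simp add: adapted_basis_def S3_lie_algebra_def Y_def prod_eq_iff)
  have "cross3 (Y 1) (Y 2) = Y 3" "cross3 (Y 2) (Y 3) = Y 1" "cross3 (Y 3) (Y 1) = Y 2"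
    using assms by (simp_all add: adapted_basis_def lie_bracket_eq_cross3 X)
  moreover from this have
    "cross3 (Y 2) (Y 1) = - Y 3" "cross3 (Y 3) (Y 2) = - Y 1" "cross3 (Y 1) (Y 3) = - Y 2"
    using cross_skew by metis+
  ultimately have "cross3 (\<Sum>i\<in>UNIV. v $ i *\<^sub>R Y i) (\<Sum>i\<in>UNIV. w $ i *\<^sub>R Y i) =
      (\<Sum>i\<in>UNIV. cross3 v w $ i *\<^sub>R Y i)"
    by (simp add: sum_3 cross_add_left cross_add_right cross_mult_left cross_mult_right
        cross_components algebra_simps)
  then show ?thesis
    by (simp add: lie_bracket_eq_cross3 lin_comb_def X snd_sum prod_eq_iff fst_sum)
qed

text \<open>Orthonormality only gives \<open>b = \<plusminus> t \<times> n\<close>, since it makes \<open>b \<times> (t \<times> n)\<close> vanish; the sign of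
  the determinant \<open>b \<bullet> (t \<times> n)\<close> selects the plus sign.\<close>

lemma cross3_positive_orthonormal:
  fixes t n b :: "real^3"
  assumes "norm t = 1" "norm n = 1" "norm b = 1" "t \<bullet> n = 0" "t \<bullet> b = 0" "n \<bullet> b = 0"
    and pos: "0 < det (vector [t, n, b] :: real^3^3)"
  shows "cross3 t n = b" and "cross3 t b = - n"
proof -
  define c where "c = cross3 t n"
  have "norm c = 1"
    using norm_cross_dot [of t n] assms by (simp add: c_def power2_eq_1_iff)
      (smt (verit) norm_ge_zero)
  have "cross3 b c = 0"
    using assms by (simp add: c_def Lagrange inner_commute)
  then have "(b \<bullet> c)\<^sup>2 = 1"
    using norm_cross_dot [of b c] assms \<open>norm c = 1\<close> by simp
  moreover have "0 < b \<bullet> c"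
    using pos by (simp add: c_def cross3_simps)
  ultimately have "b \<bullet> c = 1"
    by (auto simp: power2_eq_1_iff)
  then have "(norm (b - c))\<^sup>2 = 0"
    using assms \<open>norm c = 1\<close>
    by (simp add: power2_norm_eq_inner inner_diff inner_commute norm_eq_1)
  then show b: "cross3 t n = b"
    by (simp add: c_def)
  have "cross3 t (cross3 t n) = - n"
    using assms by (simp add: Lagrange norm_eq_1)
  then show "cross3 t b = - n"
    by (simp add: b)
qed

lemma has_vector_derivative_of_cov_deriv:
  assumes X: "adapted_basis X" and W: "smooth_along I W" and s: "s \<in> I"
    and cov: "cov_deriv X I T W s = lin_comb X w"
  shows "(W has_vector_derivative w - cross3 (T s) (W s)) (at s within I)"
proof -
  have "W differentiable (at s within I)"
    using W s unfolding smooth_along_def by (metis differentiableI_vector)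
  then have W': "(W has_vector_derivative vector_derivative W (at s within I)) (at s within I)"
    by (simp add: vector_derivative_works)
  have "lin_comb X (vector_derivative W (at s within I) + cross3 (T s) (W s)) = lin_comb X w"
    using cov by (simp add: cov_deriv_def lie_bracket_lin_comb [OF X]
        linear_add [OF linear_lin_comb])
  then have "vector_derivative W (at s within I) = w - cross3 (T s) (W s)"
    unfolding lin_comb_eq_iff [OF X] by (simp add: eq_diff_eq)
  with W' show ?thesis
    by simp
qed

lemma frenet_apparatus_imp_frenet_equations:
  assumes X: "adapted_basis X" and F: "frenet_apparatus X I \<alpha> T N B \<kappa> \<tau>"
  shows "frenet_equations I T N B \<kappa> \<tau>"
  unfolding frenet_equations_def
proof (intro ballI conjI)
  fix s assume s: "s \<in> I"
  have smooth: "smooth_along I T" "smooth_along I N" "smooth_along I B"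
    using F by (simp_all add: frenet_apparatus_def adapted_frame_def)
  have cross: "cross3 (T s) (N s) = B s" "cross3 (T s) (B s) = - N s"
    using F s by (auto simp: frenet_apparatus_def adapted_frame_def
        intro!: cross3_positive_orthonormal)
  have cov: "cov_deriv X I T T s = lin_comb X (\<kappa> s *\<^sub>R N s)"
    "cov_deriv X I T N s = lin_comb X (- \<kappa> s *\<^sub>R T s + \<tau> s *\<^sub>R B s)"
    "cov_deriv X I T B s = lin_comb X (- \<tau> s *\<^sub>R N s)"
    using F s by (simp_all add: frenet_apparatus_def)
  show "(T has_vector_derivative \<kappa> s *\<^sub>R N s) (at s within I)"
    using has_vector_derivative_of_cov_deriv [OF X smooth(1) s cov(1)] by simp
  show "(N has_vector_derivative - \<kappa> s *\<^sub>R T s + (\<tau> s - 1) *\<^sub>R B s) (at s within I)"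
    using has_vector_derivative_of_cov_deriv [OF X smooth(2) s cov(2)]
    by (simp add: cross algebra_simps)
  show "(B has_vector_derivative - (\<tau> s - 1) *\<^sub>R N s) (at s within I)"
    using has_vector_derivative_of_cov_deriv [OF X smooth(3) s cov(3)]
    by (simp add: cross algebra_simps)
qed

theorem corollary3p5:
  fixes X :: "3 \<Rightarrow> quat" and I :: "real set" and \<alpha> :: "real \<Rightarrow> quat"
    and T N B :: "real \<Rightarrow> real^3" and \<kappa> \<tau> :: "real \<Rightarrow> real"
    and \<phi> :: "real \<Rightarrow> complex^2"
  assumes "adapted_basis X"
    and "nondegenerate_interval I"
    and "arc_length_curve I \<alpha>"
    and "adapted_frame X I \<alpha> T N B"
    and "represents_triad I \<phi> N B T"
  shows "(frenet_equations I T N B \<kappa> \<tau> \<longleftrightarrow> spinor_equation I \<phi> \<kappa> \<tau>) \<and>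
    (frenet_apparatus X I \<alpha> T N B \<kappa> \<tau> \<longrightarrow>
       frenet_equations I T N B \<kappa> \<tau> \<and> spinor_equation I \<phi> \<kappa> \<tau>)"
  using frenet_equations_iff_spinor_equation [OF assms(2,5)]
    frenet_apparatus_imp_frenet_equations [OF assms(1)] by blast

end
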